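(* Let $(S,\leq)$ be a partially ordered set, $\lambda\colon S\to\mathbb N$ a length function, and $\lambda^*\colon S\to\mathrm{Ch}(\mathbb N)$ the induced chain length function. For every $x\in S$, (C0) $\lambda^*(x)=\Bigl(\max_{x'<x}\lambda^*(x')\Bigr)\cup\{\lambda(x)\}$, where the maximum is taken in $\mathrm{Ch}(\mathbb N)$ over all $x'\in S$ with $x'<x$ (and is the empty set if $x$ is a minimal element of $S$, so that $\lambda^*(x)=\{\lambda(x)\}$ in that case).
   Context: $\mathbb N=\{1,2,3,\ldots\}$. A length function on a partially ordered set $(S,\leq)$ is a map $\lambda\colon S\to\mathbb N$ such that $x<y$ in $S$ implies $\lambda(x)<\lambda(y)$. For a partially ordered set $S$, $\mathrm{Ch}(S)$ denotes the set of all finite chains (finite totally ordered subsets, including $\emptyset$) of $S$, and $\mathrm{Ch}(S,x)=\{X\in\mathrm{Ch}(S)\mid \max X=x\}$. $\mathrm{Ch}(\mathbb N)$ is the set of finite subsets of $\mathbb N$, totally ordered by the lexicographic order: $X\leq Y$ if and only if $\min(Y\setminus X)\leq\min(X\setminus Y)$, where by convention $n<\min\emptyset$ for all $n\in\mathbb N$. The chain length function is $\lambda^*(x)=\max\{\lambda(X)\mid X\in\mathrm{Ch}(S,x)\}$ (lexicographic maximum), with $\lambda(X)=\{\lambda(z)\mid z\in X\}$. *)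

theory Defs
  imports Main "HOL-Library.Extended_Nat"
begin

text \<open>
  The partially ordered set is the universe of a type of class \<open>order\<close>. Since \<open>nat\<close> contains
  \<open>0\<close> but the values of a length function are positive integers, positivity is required explicitly.
\<close>

definition length_function :: "('a::order \<Rightarrow> nat) \<Rightarrow> bool" where
  "length_function l \<longleftrightarrow> (\<forall>x. 1 \<le> l x) \<and> (\<forall>x y. x < y \<longrightarrow> l x < l y)"

definition Ch :: "'a::order set set" where
  "Ch = {X. finite X \<and> Complete_Partial_Order.chain (\<le>) X}"

definition Ch_max :: "'a::order \<Rightarrow> 'a set set" where
  "Ch_max x = {X \<in> Ch. x \<in> X \<and> (\<forall>y\<in>X. y \<le> x)}"

definition ChN :: "nat set set" where
  "ChN = {X. finite X \<and> X \<subseteq> {1..}}"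

text \<open>
  In \<open>enat\<close> the infimum of a nonempty set of numbers is its minimum, and the infimum of the
  empty set is \<open>\<infinity>\<close>; this is the convention \<open>n < min \<emptyset>\<close>.
\<close>

definition lex_le :: "nat set \<Rightarrow> nat set \<Rightarrow> bool" where
  "lex_le X Y \<longleftrightarrow> Inf (enat ` (Y - X)) \<le> Inf (enat ` (X - Y))"

definition is_lex_max :: "nat set set \<Rightarrow> nat set \<Rightarrow> bool" where
  "is_lex_max A M \<longleftrightarrow> M \<in> A \<and> (\<forall>X\<in>A. lex_le X M)"

text \<open>The maximum of the empty family is the empty set by convention.\<close>

definition lex_max :: "nat set set \<Rightarrow> nat set" where
  "lex_max A = (if A = {} then {} else (THE M. is_lex_max A M))"

definition chain_length :: "('a::order \<Rightarrow> nat) \<Rightarrow> 'a \<Rightarrow> nat set" where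
  "chain_length l x = lex_max {l ` X | X. X \<in> Ch_max x}"


text \<open>
  The order is linear, and the maxima that occur are genuine: they exist and are unique,
  although the families of chains may be infinite.
\<close>

lemma Inf_enat_image: "A \<noteq> {} \<Longrightarrow> Inf (enat ` A) = enat (LEAST n. n \<in> A)"
proof (rule antisym)
  assume "A \<noteq> {}"
  then have "(LEAST n. n \<in> A) \<in> A" by (meson LeastI ex_in_conv)
  then show "Inf (enat ` A) \<le> enat (LEAST n. n \<in> A)" by (simp add: Inf_lower)
next
  show "enat (LEAST n. n \<in> A) \<le> Inf (enat ` A)"
    by (rule Inf_greatest) (auto intro: Least_le)
qed

lemma lex_le_refl: "lex_le X X"
  by (simp add: lex_le_def)

lemma lex_le_total: "lex_le X Y \<or> lex_le Y X"
  by (auto simp: lex_le_def)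

lemma lex_le_iff:
  "lex_le X Y \<longleftrightarrow> X = Y \<or> (\<exists>n. n \<in> Y \<and> n \<notin> X \<and> (\<forall>k<n. k \<in> X \<longleftrightarrow> k \<in> Y))"
proof
  assume le: "lex_le X Y"
  show "X = Y \<or> (\<exists>n. n \<in> Y \<and> n \<notin> X \<and> (\<forall>k<n. k \<in> X \<longleftrightarrow> k \<in> Y))"
  proof (cases "X = Y")
    case False
    define n where "n = (LEAST n. n \<in> Y - X)"
    have ne: "Y - X \<noteq> {}"
    proof
      assume e: "Y - X = {}"
      then have "X - Y \<noteq> {}" using False by auto
      then show False using le e by (simp add: lex_le_def Inf_enat_image top_enat_def)
    qed
    then have n: "n \<in> Y - X" unfolding n_def by (meson LeastI ex_in_conv)
    have "k \<in> X \<longleftrightarrow> k \<in> Y" if "k < n" for k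
    proof -
      have "k \<notin> Y - X" using that not_less_Least unfolding n_def by blast
      moreover have "k \<notin> X - Y"
      proof
        assume k: "k \<in> X - Y"
        then have "Inf (enat ` (X - Y)) \<le> enat k" by (simp add: Inf_lower)
        moreover have "enat n \<le> Inf (enat ` (X - Y))"
          using le Inf_enat_image[OF ne] by (simp add: lex_le_def n_def)
        ultimately have "enat n \<le> enat k" by (rule order_trans[rotated])
        with that show False by simp
      qed
      ultimately show ?thesis by blast
    qed
    with n show ?thesis by blast
  qed simp
next
  assume "X = Y \<or> (\<exists>n. n \<in> Y \<and> n \<notin> X \<and> (\<forall>k<n. k \<in> X \<longleftrightarrow> k \<in> Y))"
  then show "lex_le X Y"
  proof
    assume "\<exists>n. n \<in> Y \<and> n \<notin> X \<and> (\<forall>k<n. k \<in> X \<longleftrightarrow> k \<in> Y)"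
    then obtain n where n: "n \<in> Y" "n \<notin> X" "\<forall>k<n. k \<in> X \<longleftrightarrow> k \<in> Y" by blast
    have "Inf (enat ` (Y - X)) \<le> enat n" using n by (simp add: Inf_lower)
    also have "enat n \<le> Inf (enat ` (X - Y))"
    proof (rule Inf_greatest)
      fix z assume "z \<in> enat ` (X - Y)"
      then obtain k where k: "z = enat k" "k \<in> X" "k \<notin> Y" by blast
      then have "\<not> k < n" using n(3) by blast
      then show "enat n \<le> z" using k(1) by simp
    qed
    finally show ?thesis by (simp add: lex_le_def)
  qed (simp add: lex_le_refl)
qed

lemma lex_le_antisym:
  assumes "lex_le X Y" "lex_le Y X"
  shows "X = Y"
proof (rule ccontr)
  assume "X \<noteq> Y"
  with assms obtain m n where "m \<in> Y" "m \<notin> X" "\<forall>k<m. k \<in> X \<longleftrightarrow> k \<in> Y"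
    "n \<in> X" "n \<notin> Y" "\<forall>k<n. k \<in> Y \<longleftrightarrow> k \<in> X"
    unfolding lex_le_iff by blast
  then show False by (metis linorder_neqE_nat)
qed

lemma lex_le_trans:
  assumes "lex_le X Y" "lex_le Y Z"
  shows "lex_le X Z"
proof (cases "X = Y \<or> Y = Z")
  case True
  then show ?thesis using assms by blast
next
  case False
  with assms obtain m n where m: "m \<in> Y" "m \<notin> X" "\<forall>k<m. k \<in> X \<longleftrightarrow> k \<in> Y"
    and n: "n \<in> Z" "n \<notin> Y" "\<forall>k<n. k \<in> Y \<longleftrightarrow> k \<in> Z"
    unfolding lex_le_iff by blast
  have "min m n \<in> Z \<and> min m n \<notin> X \<and> (\<forall>k<min m n. k \<in> X \<longleftrightarrow> k \<in> Z)"
    using m n by (cases m n rule: linorder_cases) (auto simp: min_def)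
  then show ?thesis unfolding lex_le_iff by blast
qed

lemma is_lex_max_unique: "is_lex_max A M \<Longrightarrow> is_lex_max A N \<Longrightarrow> M = N"
  unfolding is_lex_max_def by (metis lex_le_antisym)

lemma is_lex_max_exists: "finite A \<Longrightarrow> A \<noteq> {} \<Longrightarrow> \<exists>M. is_lex_max A M"
proof (induction A rule: finite_ne_induct)
  case (singleton X)
  then show ?case by (auto simp: is_lex_max_def lex_le_refl)
next
  case (insert X A)
  then obtain M where "is_lex_max A M" by blast
  then show ?case
    using lex_le_total[of X M] lex_le_trans[of _ M X] lex_le_refl[of X]
    unfolding is_lex_max_def by blast
qed

lemma is_lex_max_lex_max:
  assumes "finite A" "A \<noteq> {}"
  shows "is_lex_max A (lex_max A)"
proof -
  obtain M where "is_lex_max A M" using is_lex_max_exists assms by blast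
  then have "is_lex_max A (THE M. is_lex_max A M)"
    by (metis theI is_lex_max_unique)
  then show ?thesis using assms by (simp add: lex_max_def)
qed

lemma Ch_max_image_subset:
  assumes "length_function l" "X \<in> Ch_max x"
  shows "l ` X \<subseteq> {1..l x}"
  using assms by (fastforce simp: length_function_def Ch_max_def le_less)

lemma is_lex_max_chain_length:
  assumes "length_function l"
  shows "is_lex_max {l ` X | X. X \<in> Ch_max x} (chain_length l x)"
  unfolding chain_length_def
proof (rule is_lex_max_lex_max)
  have "{l ` X | X. X \<in> Ch_max x} \<subseteq> Pow {1..l x}"
    using Ch_max_image_subset[OF assms] by auto
  then show "finite {l ` X | X. X \<in> Ch_max x}" by (rule finite_subset) simp
  have "{x} \<in> Ch_max x" by (simp add: Ch_max_def Ch_def chain_def)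
  then show "{l ` X | X. X \<in> Ch_max x} \<noteq> {}" by blast
qed

lemma chain_length_subset:
  assumes "length_function l"
  shows "chain_length l x \<subseteq> {1..l x}"
  using is_lex_max_chain_length[OF assms, of x] Ch_max_image_subset[OF assms]
  unfolding is_lex_max_def by blast

lemma chain_length_in_ChN: "length_function l \<Longrightarrow> chain_length l x \<in> ChN"
  using chain_length_subset[of l x] by (auto simp: ChN_def intro: finite_subset)

lemma is_lex_max_below:
  assumes "length_function l" "y < x"
  shows "is_lex_max {chain_length l x' | x'. x' < x} (lex_max {chain_length l x' | x'. x' < x})"
proof (rule is_lex_max_lex_max)
  have "chain_length l x' \<subseteq> {1..l x}" if "x' < x" for x'
  proof -
    have "l x' \<le> l x" using assms(1) that by (simp add: length_function_def less_imp_le)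
    then show ?thesis using chain_length_subset[OF assms(1), of x'] by fastforce
  qed
  then have "{chain_length l x' | x'. x' < x} \<subseteq> Pow {1..l x}" by blast
  then show "finite {chain_length l x' | x'. x' < x}" by (rule finite_subset) simp
  show "{chain_length l x' | x'. x' < x} \<noteq> {}" using assms(2) by blast
qed

end

theory Submission
  imports Defs
begin

text \<open>
  The chains with maximum \<open>x\<close> are the sets \<open>Z \<union> {x}\<close> with \<open>Z\<close> empty or a chain whose maximum
  lies below \<open>x\<close>. All values of \<open>l\<close> on \<open>Z\<close> are smaller than \<open>l x\<close>, so adding \<open>l x\<close> to the image
  of \<open>Z\<close> preserves the lexicographic comparison, and maximising over \<open>Z \<union> {x}\<close> amounts to
  maximising over \<open>Z\<close>.
\<close>

text \<open>\<open>lex_le\<close> looks only at the two set differences, and an element new to both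
  sets cancels from them.\<close>

lemma lex_le_insert:
  assumes "n \<notin> X" "n \<notin> Y"
  shows "lex_le (insert n X) (insert n Y) \<longleftrightarrow> lex_le X Y"
proof -
  have "insert n X - insert n Y = X - Y" "insert n Y - insert n X = Y - X"
    using assms by auto
  then show ?thesis by (simp add: lex_le_def)
qed

lemma lex_le_empty: "lex_le {} Y"
  by (simp add: lex_le_def top_enat_def)

lemma insert_in_Ch_max:
  assumes "Z \<in> Ch_max y" "y < x"
  shows "insert x Z \<in> Ch_max x"
  using assms by (fastforce simp: Ch_max_def Ch_def chain_def)

text \<open>A finite nonempty chain has a maximal element, which comparability makes its greatest;
  this is \<open>y\<close>.\<close>

lemma Ch_max_remove:
  assumes "Z \<in> Ch_max x" "Z \<noteq> {x}"
  obtains y where "y < x" "Z - {x} \<in> Ch_max y"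
proof -
  let ?Z = "Z - {x}"
  have fin: "finite ?Z" and ne: "?Z \<noteq> {}"
    using assms by (auto simp: Ch_max_def Ch_def)
  obtain y where y: "y \<in> ?Z" "\<forall>z\<in>?Z. y \<le> z \<longrightarrow> y = z"
    using finite_has_maximal[OF fin ne] by blast
  have chain: "z \<le> w \<or> w \<le> z" if "z \<in> Z" "w \<in> Z" for z w
    using assms(1) that by (auto simp: Ch_max_def Ch_def chain_def)
  have "z \<le> y" if "z \<in> ?Z" for z
    using y chain[of z y] that by auto
  moreover have "y < x"
    using y(1) assms(1) by (auto simp: Ch_max_def)
  moreover have "?Z \<in> Ch"
    using assms(1) by (auto simp: Ch_max_def Ch_def chain_def)
  ultimately show thesis
    using that y(1) by (auto simp: Ch_max_def)
qed

text \<open>If anything remains below \<open>x\<close>, its image competes for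
  \<open>chain_length l y\<close> at its own maximum \<open>y\<close>, and that set competes for the
  maximum on the right.\<close>

lemma lex_le_Ch_max_remove:
  assumes "length_function l" "Z \<in> Ch_max x"
  shows "lex_le (l ` (Z - {x})) (lex_max {chain_length l x' | x'. x' < x})"
proof (cases "Z = {x}")
  case True
  then show ?thesis by (simp add: lex_le_empty)
next
  case False
  with assms(2) obtain y where y: "y < x" "Z - {x} \<in> Ch_max y"
    by (rule Ch_max_remove)
  have "lex_le (l ` (Z - {x})) (chain_length l y)"
    using is_lex_max_chain_length[OF assms(1), of y] y(2) unfolding is_lex_max_def by blast
  moreover have "lex_le (chain_length l y) (lex_max {chain_length l x' | x'. x' < x})"
    using is_lex_max_below[OF assms(1) y(1)] y(1) unfolding is_lex_max_def by blast
  ultimately show ?thesis by (rule lex_le_trans)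
qed

text \<open>A chain realising the largest \<open>chain_length\<close> below \<open>x\<close> is
  extended by \<open>x\<close>.\<close>

lemma insert_lex_max_below_attained:
  assumes "length_function l"
  shows "\<exists>Z\<in>Ch_max x. insert (l x) (lex_max {chain_length l x' | x'. x' < x}) = l ` Z"
proof (cases "\<exists>y. y < x")
  case True
  then obtain y where "lex_max {chain_length l x' | x'. x' < x} = chain_length l y" "y < x"
    using is_lex_max_below[OF assms] unfolding is_lex_max_def by blast
  moreover obtain Z where "Z \<in> Ch_max y" "chain_length l y = l ` Z"
    using is_lex_max_chain_length[OF assms, of y] unfolding is_lex_max_def by blast
  ultimately show ?thesis
    using insert_in_Ch_max by (intro bexI[of _ "insert x Z"]) auto
next
  case False
  \<comment> \<open>For minimal \<open>x\<close> the maximum is empty by convention, so the chain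
    \<open>{x}\<close> serves as witness.\<close>
  then show ?thesis
    by (intro bexI[of _ "{x}"]) (auto simp: lex_max_def Ch_max_def Ch_def chain_def)
qed

text \<open>Allows \<open>l x\<close> to be cancelled by \<open>lex_le_insert\<close>: for
  \<open>y < x\<close> the elements of \<open>chain_length l y\<close> are at most
  \<open>l y\<close>, which is less than \<open>l x\<close>.\<close>

lemma not_in_lex_max_below:
  assumes "length_function l"
  shows "l x \<notin> lex_max {chain_length l x' | x'. x' < x}"
proof (cases "\<exists>y. y < x")
  case True
  then obtain y where "lex_max {chain_length l x' | x'. x' < x} = chain_length l y" "y < x"
    using is_lex_max_below[OF assms] unfolding is_lex_max_def by blast
  moreover have "l y < l x"
    using assms \<open>y < x\<close> by (simp add: length_function_def)
  ultimately show ?thesis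
    using chain_length_subset[OF assms, of y] by auto
next
  case False
  then show ?thesis by (simp add: lex_max_def)
qed

theorem mainTheorem3:
  fixes l :: "'a::order \<Rightarrow> nat" and x :: 'a
  assumes "length_function l"
  shows "chain_length l x = lex_max {chain_length l x' | x'. x' < x} \<union> {l x}
    \<and> (\<not> (\<exists>x'. x' < x) \<longrightarrow> chain_length l x = {l x})"
proof -
  let ?M = "lex_max {chain_length l x' | x'. x' < x}"
  have "lex_le (l ` Z) (insert (l x) ?M)" if Z: "Z \<in> Ch_max x" for Z
  proof -
    have "l ` Z = insert (l x) (l ` (Z - {x}))"
      using Z by (auto simp: Ch_max_def)
    moreover have "l x \<notin> l ` (Z - {x})"
    proof
      assume "l x \<in> l ` (Z - {x})"
      then obtain z where "l z = l x" "z \<in> Z" "z \<noteq> x" by force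
      moreover from this have "z < x"
        using Z by (simp add: Ch_max_def order.strict_iff_order)
      ultimately show False
        using assms by (metis length_function_def less_irrefl)
    qed
    ultimately show ?thesis
      using lex_le_Ch_max_remove[OF assms Z] not_in_lex_max_below[OF assms]
      by (simp add: lex_le_insert)
  qed
  \<comment> \<open>An upper bound that belongs to the family is its maximum.\<close>
  then have "is_lex_max {l ` Z | Z. Z \<in> Ch_max x} (insert (l x) ?M)"
    using insert_lex_max_below_attained[OF assms, of x] unfolding is_lex_max_def by blast
  then have "chain_length l x = insert (l x) ?M"
    using is_lex_max_chain_length[OF assms] is_lex_max_unique by blast
  moreover have "?M = {}" if "\<not> (\<exists>x'. x' < x)"
    using that by (simp add: lex_max_def)
  ultimately show ?thesis by auto
qed

end
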